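(* Let $0<\kappa\leq 1$ and $0<\varepsilon<\frac{\kappa}{6}$, and let $G$ be a $\kappa$-expander. Then for any subgraph $H$ of $G$ satisfying $e(H)\geq (1-\varepsilon)\, e(G)$, there exists an induced subgraph $H^*$ of $H$ such that $e(H^* )\geq \left(1-\frac{6\varepsilon}{\kappa}\right)e(G)$ and $H^*$ is a $\frac{\kappa}{3}$-expander.
   Context: A graph $G$ consists of a finite set $V(G)$ of vertices and a finite multiset $E(G)$ of edges, which are unordered pairs of not necessarily distinct vertices (so loops and multiple edges are allowed). $e(G)$ is the number of edges. The degree $\deg(v)$ of a vertex is the number of non-loop edges containing it plus twice the number of loops at it. For $X\subset V(G)$: $\overline X=V(G)\setminus X$, $\mathrm{vol}_G(X)=\sum_{v\in X}\deg(v)$, and $e_G(X,\overline X)$ is the number of edges with one endpoint in $X$ and one in $\overline X$. The edge-expansion of $X$ is $h_G(X)=\frac{e_G(X,\overline X)}{\min(\mathrm{vol}_G(X),\mathrm{vol}_G(\overline X))}$. $G$ is a $\kappa$-expander if $h_G(X)\ge\kappa$ for all $X\subset V(G)$, the condition being vacuous when the denominator is $0$; equivalently, $e_G(X,\overline X)\ge \kappa\min(\mathrm{vol}_G(X),\mathrm{vol}_G(\overline X))$ for all $X\subset V(G)$. A subgraph of $G$ is a graph obtained from $G$ by deleting some vertices (together with their incident edges) and some edges. An induced subgraph of $G$ is a graph obtained from $G$ by deleting some vertices (together with their incident edges). *)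

theory Defs
  imports Complex_Main "HOL-Library.Multiset" "HOL-Library.Uprod"
begin

text \<open>Loops are the unordered pairs \<^term>\<open>Upair v v\<close>; parallel edges are
  repeated elements of the edge multiset. The empty graph is allowed.\<close>

record 'a multigraph =
  verts :: "'a set"
  edges :: "'a uprod multiset"

definition wf_multigraph :: "'a multigraph \<Rightarrow> bool" where
  "wf_multigraph G \<longleftrightarrow> finite (verts G) \<and> (\<forall>e \<in># edges G. set_uprod e \<subseteq> verts G)"

abbreviation num_edges :: "'a multigraph \<Rightarrow> nat" where
  "num_edges G \<equiv> size (edges G)"

definition deg :: "'a multigraph \<Rightarrow> 'a \<Rightarrow> nat" where
  "deg G v = size {#e \<in># edges G. v \<in> set_uprod e \<and> e \<noteq> Upair v v#}
             + 2 * count (edges G) (Upair v v)"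

definition vol :: "'a multigraph \<Rightarrow> 'a set \<Rightarrow> nat" where
  "vol G X = (\<Sum>v\<in>X. deg G v)"

definition edges_between :: "'a multigraph \<Rightarrow> 'a set \<Rightarrow> 'a set \<Rightarrow> nat" where
  "edges_between G X Y = size {#e \<in># edges G. \<exists>x\<in>X. \<exists>y\<in>Y. e = Upair x y#}"

definition edge_expansion :: "'a multigraph \<Rightarrow> 'a set \<Rightarrow> real" where
  "edge_expansion G X =
     real (edges_between G X (verts G - X)) / real (min (vol G X) (vol G (verts G - X)))"

definition expander :: "real \<Rightarrow> 'a multigraph \<Rightarrow> bool" where
  "expander \<kappa> G \<longleftrightarrow>
     (\<forall>X \<subseteq> verts G. min (vol G X) (vol G (verts G - X)) \<noteq> 0 \<longrightarrow> edge_expansion G X \<ge> \<kappa>)"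

definition delete_verts :: "'a multigraph \<Rightarrow> 'a set \<Rightarrow> 'a multigraph" where
  "delete_verts G S =
     \<lparr>verts = verts G - S, edges = {#e \<in># edges G. set_uprod e \<inter> S = {}#}\<rparr>"

definition delete_edges :: "'a multigraph \<Rightarrow> 'a uprod multiset \<Rightarrow> 'a multigraph" where
  "delete_edges G F = \<lparr>verts = verts G, edges = edges G - F\<rparr>"

definition induced_subgraph :: "'a multigraph \<Rightarrow> 'a multigraph \<Rightarrow> bool" where
  "induced_subgraph H G \<longleftrightarrow> (\<exists>S \<subseteq> verts G. H = delete_verts G S)"

definition subgraph :: "'a multigraph \<Rightarrow> 'a multigraph \<Rightarrow> bool" where
  "subgraph H G \<longleftrightarrow>
     (\<exists>S F. S \<subseteq> verts G \<and> F \<subseteq># edges (delete_verts G S) \<and>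
            H = delete_edges (delete_verts G S) F)"

lemma expander_iff:
  "expander \<kappa> G \<longleftrightarrow>
     (\<forall>X \<subseteq> verts G. real (edges_between G X (verts G - X))
        \<ge> \<kappa> * real (min (vol G X) (vol G (verts G - X))))"
proof -
  have *: "m \<noteq> 0 \<longrightarrow> \<kappa> \<le> real a / real m \<longleftrightarrow> \<kappa> * real m \<le> real a" for a m :: nat
    by (cases "m = 0") (simp_all add: pos_le_divide_eq)
  show ?thesis
    unfolding expander_def edge_expansion_def using * by (metis div_by_0 mult_zero_right of_nat_0 of_nat_0_le_iff)
qed

lemma wf_multigraph_subgraph:
  assumes "wf_multigraph G" "subgraph H G"
  shows "wf_multigraph H"
  using assms
  by (fastforce simp: wf_multigraph_def subgraph_def delete_verts_def delete_edges_def
      dest: in_diffD)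

lemma subgraph_iff:
  assumes "wf_multigraph G"
  shows "subgraph H G \<longleftrightarrow> wf_multigraph H \<and> verts H \<subseteq> verts G \<and> edges H \<subseteq># edges G"
proof
  assume H: "subgraph H G"
  then have "wf_multigraph H" using assms by (rule wf_multigraph_subgraph[rotated])
  moreover from H have "verts H \<subseteq> verts G \<and> edges H \<subseteq># edges G"
    unfolding subgraph_def delete_verts_def delete_edges_def
    by (auto intro: subset_mset.order_trans[OF diff_subset_eq_self multiset_filter_subset])
  ultimately show "wf_multigraph H \<and> verts H \<subseteq> verts G \<and> edges H \<subseteq># edges G" by blast
next
  assume H: "wf_multigraph H \<and> verts H \<subseteq> verts G \<and> edges H \<subseteq># edges G"
  define S where "S = verts G - verts H"
  have "{#e \<in># edges H. set_uprod e \<inter> S = {}#} = edges H"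
    using H by (subst filter_mset_eq_conv) (auto simp: wf_multigraph_def S_def)
  moreover have "{#e \<in># edges H. set_uprod e \<inter> S = {}#} \<subseteq># edges (delete_verts G S)"
    using H by (simp add: delete_verts_def multiset_filter_mono)
  ultimately have sub: "edges H \<subseteq># edges (delete_verts G S)" by simp
  have "verts H = verts (delete_verts G S)" using H by (auto simp: delete_verts_def S_def)
  moreover have "edges (delete_verts G S) - (edges (delete_verts G S) - edges H) = edges H"
    using sub by (auto simp: multiset_eq_iff subseteq_mset_def)
  ultimately have "H = delete_edges (delete_verts G S) (edges (delete_verts G S) - edges H)"
    by (simp add: delete_edges_def)
  then show "subgraph H G"
    unfolding subgraph_def using S_def diff_subset_eq_self by (metis Diff_subset)
qed

end

theory Submission
  imports Defs
begin

text \<open>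
  A vertex set of small volume is thrown away so that the rest spans an expander. Write \<open>m\<close> for
  the number of edges of \<open>G\<close> and \<open>d\<close> for the number of edges of \<open>G\<close> missing in \<open>H\<close>. The naive
  procedure repeatedly removes from \<open>H\<close> the lighter side of a cut that violates
  \<open>\<kappa> / 3\<close>-expansion. The union \<open>Z\<close> of the removed sets then keeps the property
  that \<open>H\<close> has at most \<open>\<kappa> / 3 * vol G Z\<close> edges leaving \<open>Z\<close>, because each removal adds at most
  \<open>\<kappa> / 3\<close> times the volume of the set removed. In \<open>G\<close> at most \<open>d\<close> further edges leave \<open>Z\<close>,
  whereas expansion of \<open>G\<close> demands \<open>\<kappa> * vol G Z\<close> of them as long as \<open>Z\<close> is the lighter side.
  Comparing the two gives \<open>vol G Z \<le> 3 * d / (2 * \<kappa>)\<close> (lemma \<open>vol_of_sparsely_cut_set\<close>), so few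
  edges are lost (lemma \<open>num_edges_delete_verts\<close>).

  The danger is that one removal makes \<open>Z\<close> the heavier side. This cannot happen: if the remaining
  set \<open>Y\<close> were lighter than its complement, the same comparison, with \<open>vol G Y\<close> bounding the
  volume of the set just removed, would make \<open>vol G Y\<close> small too; but \<open>Y\<close> is the heavier side of
  a cut of a graph that retains almost all edges.

  The iteration is replaced by the choice of a smallest vertex set \<open>W\<close> whose complement has the
  invariant; the step above contradicts minimality unless \<open>H\<close> induces an expander on \<open>W\<close>.

  Counting rests on writing volumes as sums over edges (lemma \<open>vol_eq_sum_endpoints\<close>), which
  makes them additive in the edge multiset.
\<close>

section \<open>Volumes and cuts as sums over edges\<close>

text \<open>The ends of an edge with multiplicity: a loop contributes its vertex twice, which is exactly
  its contribution to the degree.\<close>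

lift_definition mset_uprod :: "'a uprod \<Rightarrow> 'a multiset" is "\<lambda>(a, b). {#a, b#}"
  by (auto simp: add_mset_commute)

lemma mset_uprod_Upair [simp]: "mset_uprod (Upair a b) = {#a, b#}"
  by transfer simp

lemma deg_eq_sum_count:
  "deg G v = (\<Sum>e\<in>#edges G. count (mset_uprod e) v)"
proof -
  have *: "size {#e \<in># M. v \<in> set_uprod e \<and> e \<noteq> Upair v v#} + 2 * count M (Upair v v)
      = (\<Sum>e\<in>#M. count (mset_uprod e) v)" for M :: "'a uprod multiset"
  proof (induction M)
    case (add e M)
    then show ?case by (cases e) auto
  qed simp
  show ?thesis unfolding deg_def by (rule *)
qed

lemma vol_eq_sum_endpoints:
  assumes "finite X"
  shows "vol G X = (\<Sum>e\<in>#edges G. size {#v \<in># mset_uprod e. v \<in> X#})"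
proof -
  have one: "(\<Sum>v\<in>X. count N v) = size {#v \<in># N. v \<in> X#}" for N :: "'a multiset"
  proof (induction N)
    case (add a N)
    have "(\<Sum>v\<in>X. count (add_mset a N) v) = (\<Sum>v\<in>X. (if v = a then 1 else 0) + count N v)"
      by (intro sum.cong) auto
    then show ?case using add assms by (simp add: sum.distrib)
  qed simp
  have "(\<Sum>v\<in>X. \<Sum>e\<in>#M. count (mset_uprod e) v) = (\<Sum>e\<in>#M. \<Sum>v\<in>X. count (mset_uprod e) v)"
    for M :: "'a uprod multiset"
    by (induction M) (auto simp: sum.distrib)
  then show ?thesis by (simp add: vol_def deg_eq_sum_count one)
qed

lemma vol_mono_edges:
  assumes "finite X" "edges H \<subseteq># edges G"
  shows "vol H X \<le> vol G X"
proof -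
  obtain D where "edges G = edges H + D"
    using assms(2) by (auto simp: mset_subset_eq_exists_conv)
  then show ?thesis using assms(1) by (simp add: vol_eq_sum_endpoints)
qed

lemma vol_Un_disjoint:
  assumes "finite X" "finite Y" "X \<inter> Y = {}"
  shows "vol G (X \<union> Y) = vol G X + vol G Y"
  using assms by (simp add: vol_def sum.union_disjoint)

lemma vol_verts:
  assumes "wf_multigraph G"
  shows "vol G (verts G) = 2 * num_edges G"
proof -
  have two: "size {#v \<in># mset_uprod e. v \<in> verts G#} = 2" if "e \<in># edges G" for e
    using assms that unfolding wf_multigraph_def by (cases e) force
  have "vol G (verts G) = (\<Sum>e\<in>#edges G. 2)"
    using assms two by (simp add: vol_eq_sum_endpoints wf_multigraph_def cong: image_mset_cong)
  then show ?thesis by simp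
qed

text \<open>Every end in \<open>X\<close> belongs to a deleted edge, and an edge has only two ends.\<close>

lemma vol_le_deleted_edges:
  assumes "finite X" "edges H \<subseteq># edges G" "vol H X = 0"
  shows "vol G X \<le> 2 * (num_edges G - num_edges H)"
proof -
  obtain D where D: "edges G = edges H + D"
    using assms(2) by (auto simp: mset_subset_eq_exists_conv)
  have "size {#v \<in># mset_uprod e. v \<in> X#} \<le> 2" for e :: "'a uprod"
    by (cases e) auto
  then have "(\<Sum>e\<in>#D. size {#v \<in># mset_uprod e. v \<in> X#}) \<le> (\<Sum>e\<in>#D. 2)"
    by (intro sum_mset_mono)
  then have "vol G X \<le> vol H X + 2 * size D"
    using assms(1) D by (simp add: vol_eq_sum_endpoints mult.commute)
  then show ?thesis using assms(3) D by simp
qed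

lemma edges_between_commute: "edges_between G X Y = edges_between G Y X"
  unfolding edges_between_def by (metis Upair_inject)

lemma edges_between_deleted_edges:
  assumes "edges H \<subseteq># edges G"
  shows "edges_between G X Y \<le> edges_between H X Y + (num_edges G - num_edges H)"
proof -
  obtain D where "edges G = edges H + D"
    using assms by (auto simp: mset_subset_eq_exists_conv)
  then show ?thesis by (simp add: edges_between_def size_filter_mset_lesseq)
qed

lemma edges_between_Un_le:
  "edges_between G (X \<union> X') Y \<le> edges_between G X Y + edges_between G X' Y"
proof -
  have "size {#e \<in># M. \<exists>x\<in>X \<union> X'. \<exists>y\<in>Y. e = Upair x y#}
      \<le> size {#e \<in># M. \<exists>x\<in>X. \<exists>y\<in>Y. e = Upair x y#}
        + size {#e \<in># M. \<exists>x\<in>X'. \<exists>y\<in>Y. e = Upair x y#}" for M :: "'a uprod multiset"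
    by (induction M) auto
  then show ?thesis unfolding edges_between_def .
qed

lemma edges_between_mono:
  assumes "Y \<subseteq> Y'"
  shows "edges_between G X Y \<le> edges_between G X Y'"
proof -
  have "size {#e \<in># M. \<exists>x\<in>X. \<exists>y\<in>Y. e = Upair x y#}
      \<le> size {#e \<in># M. \<exists>x\<in>X. \<exists>y\<in>Y'. e = Upair x y#}" for M :: "'a uprod multiset"
    using assms by (induction M) auto
  then show ?thesis unfolding edges_between_def .
qed

lemma edges_between_delete_verts:
  assumes "X \<inter> S = {}" "Y \<inter> S = {}"
  shows "edges_between (delete_verts G S) X Y = edges_between G X Y"
proof -
  have "{#e \<in># edges G. set_uprod e \<inter> S = {} \<and> (\<exists>x\<in>X. \<exists>y\<in>Y. e = Upair x y)#}
      = {#e \<in># edges G. \<exists>x\<in>X. \<exists>y\<in>Y. e = Upair x y#}"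
    by (rule filter_mset_cong) (use assms in auto)
  then show ?thesis by (simp add: edges_between_def delete_verts_def filter_filter_mset)
qed

text \<open>Each edge destroyed by deleting \<open>S\<close> has an end in \<open>S\<close>.\<close>

lemma num_edges_delete_verts:
  assumes "finite S"
  shows "num_edges G \<le> num_edges (delete_verts G S) + vol G S"
proof -
  have one: "1 \<le> size {#v \<in># mset_uprod e. v \<in> S#}" if "set_uprod e \<inter> S \<noteq> {}" for e
    using that by (cases e) auto
  have "size M \<le> size {#e \<in># M. set_uprod e \<inter> S = {}#}
      + (\<Sum>e\<in>#M. size {#v \<in># mset_uprod e. v \<in> S#})" for M :: "'a uprod multiset"
  proof (induction M)
    case (add e M)
    show ?case
    proof (cases "set_uprod e \<inter> S = {}")
      case False
      then show ?thesis using add one[OF False] by simp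
    qed (use add in simp)
  qed simp
  then show ?thesis using assms by (simp add: delete_verts_def vol_eq_sum_endpoints)
qed

lemma wf_delete_verts:
  "wf_multigraph G \<Longrightarrow> wf_multigraph (delete_verts G S)"
  by (auto simp: wf_multigraph_def delete_verts_def)

section \<open>Removing sparsely cut sets\<close>

text \<open>Passing from \<open>H\<close> to \<open>G\<close>, the deleted edges must supply the missing two thirds of the
  \<open>\<kappa> * vol G Z\<close> edges that expansion of \<open>G\<close> demands across the cut.\<close>

lemma vol_of_sparsely_cut_set:
  assumes "0 < \<kappa>" "expander \<kappa> G" "edges H \<subseteq># edges G" "Z \<subseteq> verts G"
    and "real (edges_between H Z (verts G - Z)) \<le> \<kappa> / 3 * vol G Z"
    and "vol G Z \<le> vol G (verts G - Z)"
  shows "2 * \<kappa> * vol G Z \<le> 3 * real (num_edges G - num_edges H)"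
proof -
  have "\<kappa> * vol G Z \<le> edges_between G Z (verts G - Z)"
    using assms(2,4,6) unfolding expander_iff by (metis min.absorb1)
  also have "\<dots> \<le> edges_between H Z (verts G - Z) + real (num_edges G - num_edges H)"
    using edges_between_deleted_edges[OF assms(3)] by (metis of_nat_add of_nat_le_iff)
  finally show ?thesis using assms(5) by simp
qed

theorem theorem2:
  fixes \<kappa> \<epsilon> :: real and G H :: "'a multigraph"
  assumes "0 < \<kappa>" and "\<kappa> \<le> 1"
    and "0 < \<epsilon>" and "\<epsilon> < \<kappa> / 6"
    and "wf_multigraph G" and "expander \<kappa> G"
    and "subgraph H G"
    and "real (num_edges H) \<ge> (1 - \<epsilon>) * real (num_edges G)"
  shows "\<exists>H'. induced_subgraph H' H
           \<and> real (num_edges H') \<ge> (1 - 6 * \<epsilon> / \<kappa>) * real (num_edges G)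
           \<and> expander (\<kappa> / 3) H'"
proof -
  have wfH: "wf_multigraph H" and VH: "verts H \<subseteq> verts G" and EH: "edges H \<subseteq># edges G"
    using assms(5,7) by (simp_all add: subgraph_iff)
  have fin: "finite X" if "X \<subseteq> verts G" for X
    using assms(5) that finite_subset unfolding wf_multigraph_def by blast
  define m where "m = real (num_edges G)"
  define d where "d = real (num_edges G - num_edges H)"
  \<comment> \<open>The common unit for all error terms: \<open>d \<le> \<kappa> * t\<close>, and the edge loss allowed is \<open>6 * t\<close>.\<close>
  define t where "t = \<epsilon> * m / \<kappa>"
  have m0: "0 \<le> m" by (simp add: m_def)
  have eH: "num_edges H = m - d"
    using size_mset_mono[OF EH] by (simp add: m_def d_def)
  have d: "d \<le> \<kappa> * t" using assms(1,8) eH by (simp add: m_def t_def algebra_simps)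
  have t0: "0 \<le> t" using assms m0 by (simp add: t_def)
  have dt: "d \<le> t" using d t0 assms(2) mult_left_le_one_le[of t \<kappa>] assms(1) by linarith
  have tm: "6 * t \<le> m" and tm': "m > 0 \<Longrightarrow> 6 * t < m"
  proof -
    have "6 * \<epsilon> / \<kappa> < 1" using assms(1,4) by (simp add: field_simps)
    then have "6 * \<epsilon> / \<kappa> * m \<le> m" "m > 0 \<Longrightarrow> 6 * \<epsilon> / \<kappa> * m < 1 * m"
      using m0 by (metis less_eq_real_def mult_left_le_one_le mult_right_mono mult_1,
        metis mult_strict_right_mono)
    then show "6 * t \<le> m" "m > 0 \<Longrightarrow> 6 * t < m" by (simp_all add: t_def)
  qed
  have volG: "vol G (verts G - W) + vol G W = 2 * m" if "W \<subseteq> verts G" for W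
  proof -
    have "vol G (verts G) = vol G (verts G - W) + vol G W"
      using vol_Un_disjoint[of "verts G - W" W G] fin that
      by (simp add: Un_absorb1 Un_commute Int_commute)
    then show ?thesis using vol_verts[OF assms(5)] by (simp add: m_def flip: of_nat_add)
  qed
  \<comment> \<open>The invariant of the removal procedure. Complements are taken in \<open>G\<close>, so the vertices of \<open>G\<close>
    missing in \<open>H\<close> count as removed from the start.\<close>
  define good where "good W \<longleftrightarrow> W \<subseteq> verts H
      \<and> edges_between H (verts G - W) W \<le> \<kappa> / 3 * vol G (verts G - W)
      \<and> vol G (verts G - W) \<le> vol G W" for W
  have small: "2 * real (vol G (verts G - W)) \<le> 3 * t" if "good W" for W
  proof -
    have "verts G - (verts G - W) = W" using that VH unfolding good_def by blast
    then have "2 * \<kappa> * vol G (verts G - W) \<le> 3 * d"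
      using vol_of_sparsely_cut_set[OF assms(1,6) EH, of "verts G - W"] that
      by (simp add: good_def d_def)
    also have "\<dots> \<le> \<kappa> * (3 * t)" using d by simp
    finally have "\<kappa> * (2 * real (vol G (verts G - W))) \<le> \<kappa> * (3 * t)" by (simp add: mult_ac)
    then show ?thesis using assms(1) by (rule mult_left_le_imp_le)
  qed
  have "good (verts H)"
  proof -
    have "{#e \<in># edges H. \<exists>x\<in>verts G - verts H. \<exists>y\<in>verts H. e = Upair x y#} = {#}"
      using wfH by (auto simp: wf_multigraph_def filter_mset_eq_conv)
    then have cut: "edges_between H (verts G - verts H) (verts H) = 0"
      by (simp add: edges_between_def)
    have "size {#v \<in># mset_uprod e. v \<in> verts G - verts H#} = 0" if "e \<in># edges H" for e
      using wfH that unfolding wf_multigraph_def by (cases e) force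
    then have "vol H (verts G - verts H) = 0"
      using fin by (simp add: vol_eq_sum_endpoints)
    then have "vol G (verts G - verts H) \<le> 2 * d"
      using vol_le_deleted_edges[OF _ EH] fin unfolding d_def
      by (metis Diff_subset of_nat_le_iff of_nat_mult of_nat_numeral)
    then have "vol G (verts G - verts H) \<le> m" using dt tm t0 by linarith
    then have "vol G (verts G - verts H) \<le> vol G (verts H)"
      using volG[OF VH] by linarith
    then show ?thesis using cut assms(1) by (simp add: good_def)
  qed
  then obtain W where W: "good W" and min: "\<And>W'. good W' \<Longrightarrow> card W \<le> card W'"
    using ex_has_least_nat[of good "verts H" card] by blast
  have WH: "W \<subseteq> verts H" and WG: "W \<subseteq> verts G" using W VH by (auto simp: good_def)
  define K where "K = delete_verts H (verts H - W)"
  define Z where "Z = verts G - W"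
  have vK: "verts K = W" using WH by (auto simp: K_def delete_verts_def)
  have wfK: "wf_multigraph K" using wf_delete_verts[OF wfH] by (simp add: K_def)
  have EK: "edges K \<subseteq># edges G"
    using subset_mset.order_trans[OF multiset_filter_subset EH] by (simp add: K_def delete_verts_def)
  have "num_edges H \<le> num_edges K + vol G Z"
  proof -
    have finHW: "finite (verts H - W)" using fin VH by blast
    have "vol H (verts H - W) \<le> vol G (verts H - W)" using finHW EH by (rule vol_mono_edges)
    also have "\<dots> \<le> vol G Z"
      unfolding vol_def by (intro sum_mono2) (use fin VH in \<open>auto simp: Z_def\<close>)
    finally show ?thesis
      using num_edges_delete_verts[OF finHW, of H] by (simp add: K_def)
  qed
  then have "m - d \<le> num_edges K + real (vol G Z)" using eH by linarith
  then have eK: "m - 5 / 2 * t \<le> num_edges K"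
    using small[OF W] dt unfolding Z_def by linarith
  \<comment> \<open>Removing the lighter side \<open>X\<close> of a sparse cut preserves the invariant, against minimality.\<close>
  have no_sparse_cut: False
    if X: "X \<subseteq> W" and le: "vol K X \<le> vol K (W - X)"
      and sparse: "edges_between K X (W - X) < \<kappa> / 3 * vol K X" for X
  proof -
    define Y where "Y = W - X"
    have posX: "0 < vol K X" using sparse assms(1) by (cases "vol K X") auto
    have finX: "finite X" "finite Y" "finite Z" using X WG fin by (auto simp: Y_def Z_def)
    have ZX: "verts G - Y = Z \<union> X" using X WG by (auto simp: Y_def Z_def)
    have volZX: "vol G (Z \<union> X) = vol G Z + vol G X"
      using finX X by (intro vol_Un_disjoint) (auto simp: Z_def)
    have KX: "vol K X \<le> vol G X" and KY: "vol K Y \<le> vol G Y"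
      using vol_mono_edges[OF _ EK] finX by auto
    have "vol K X + vol K Y = 2 * num_edges K"
      using vol_Un_disjoint[of X Y K] vol_verts[OF wfK] vK X finX
      by (simp add: Y_def Un_absorb1)
    then have "num_edges K \<le> vol G Y" using le KY by (simp add: Y_def)
    then have bigY: "m - 5 / 2 * t \<le> vol G Y" using eK by linarith
    have "edges_between H (Z \<union> X) Y \<le> edges_between H Z W + edges_between K X Y"
    proof -
      have "edges_between H X Y = edges_between K X Y"
        unfolding K_def using X by (intro edges_between_delete_verts[symmetric]) (auto simp: Y_def)
      then show ?thesis
        using edges_between_Un_le[of H Z X Y] edges_between_mono[of Y W H Z]
        by (simp add: Y_def)
    qed
    then have cut: "edges_between H (Z \<union> X) Y \<le> \<kappa> / 3 * (vol G Z + real (vol K X))"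
      using W sparse unfolding good_def Y_def Z_def by (simp add: distrib_left)
    \<comment> \<open>Otherwise \<open>vol G Y \<le> vol G Z / 2 + 3 / 2 * t \<le> 9 / 4 * t\<close>, while \<open>Y\<close> has volume at least
      \<open>m - 5 / 2 * t\<close>; together \<open>m \<le> 19 / 4 * t\<close>, contrary to \<open>6 * t < m\<close>.\<close>
    have "vol G (Z \<union> X) \<le> vol G Y"
    proof (rule ccontr)
      assume "\<not> ?thesis"
      then have "min (vol G Y) (vol G (verts G - Y)) = vol G Y" by (simp add: ZX)
      moreover have "Y \<subseteq> verts G" using WG by (auto simp: Y_def)
      ultimately have "\<kappa> * vol G Y \<le> edges_between G Y (verts G - Y)"
        using assms(6) unfolding expander_iff by metis
      also have "\<dots> \<le> edges_between H (Z \<union> X) Y + d"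
        using edges_between_deleted_edges[OF EH, of "Z \<union> X" Y]
        by (simp add: d_def edges_between_commute[of _ Y] ZX)
      also have "\<dots> \<le> \<kappa> / 3 * (vol G Z + real (vol G Y)) + \<kappa> * t"
      proof -
        have "vol G Z + real (vol K X) \<le> vol G Z + real (vol G Y)"
          using le KY by (simp add: Y_def)
        then have "\<kappa> / 3 * (vol G Z + real (vol K X)) \<le> \<kappa> / 3 * (vol G Z + real (vol G Y))"
          using assms(1) by (intro mult_left_mono) auto
        then show ?thesis using cut d by linarith
      qed
      finally have "\<kappa> * vol G Y \<le> \<kappa> * ((vol G Z + real (vol G Y)) / 3 + t)"
        by (simp add: algebra_simps add_divide_distrib)
      then have "vol G Y \<le> (vol G Z + real (vol G Y)) / 3 + t"
        using assms(1) by (rule mult_left_le_imp_le)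
      then have "vol G Y \<le> 9 / 4 * t"
        using small[OF W, folded Z_def] by argo
      moreover have "0 < vol G Y" using posX le KY by (simp add: Y_def)
      moreover have "m > 0"
        using volG[of Y] \<open>0 < vol G Y\<close> X WG by (force simp: Y_def)
      ultimately show False using bigY tm' t0 by linarith
    qed
    moreover have "edges_between H (Z \<union> X) Y \<le> \<kappa> / 3 * vol G (Z \<union> X)"
    proof -
      have "\<kappa> / 3 * (vol G Z + real (vol K X)) \<le> \<kappa> / 3 * vol G (Z \<union> X)"
        using assms(1) KX volZX by (intro mult_left_mono) auto
      then show ?thesis using cut by linarith
    qed
    ultimately have "good Y" using WH unfolding good_def ZX by (auto simp: Y_def)
    moreover have "X \<noteq> {}" using posX by (auto simp: vol_def)
    then have "card Y < card W"
      using X WG fin unfolding Y_def by (intro psubset_card_mono) auto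
    ultimately show False using min by fastforce
  qed
  have "expander (\<kappa> / 3) K"
    unfolding expander_iff vK
  proof (intro allI impI, rule ccontr)
    fix X assume X: "X \<subseteq> W"
      and "\<not> \<kappa> / 3 * real (min (vol K X) (vol K (W - X))) \<le> real (edges_between K X (W - X))"
    then have sparse: "edges_between K X (W - X) < \<kappa> / 3 * min (vol K X) (vol K (W - X))"
      by simp
    have WX: "W - (W - X) = X" using X by blast
    show False
    proof (cases "vol K X \<le> vol K (W - X)")
      case True
      then show False using no_sparse_cut[OF X] sparse by (simp add: min_def)
    next
      case False
      then show False
        using no_sparse_cut[of "W - X"] sparse WX edges_between_commute[of K X "W - X"]
        by (simp add: min_def)
    qed
  qed
  moreover have "induced_subgraph K H" by (auto simp: induced_subgraph_def K_def)
  moreover have "(1 - 6 * \<epsilon> / \<kappa>) * m \<le> num_edges K"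
    using eK t0 by (simp add: t_def algebra_simps)
  ultimately show ?thesis unfolding m_def by blast
qed

end
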